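(* Let $L$ be a $BL$-algebra, let $\alpha,\beta\in(0,1]$ with $\alpha<\beta$, and let $F:L\to[0,1]$ be a fuzzy set. Then $F$ is a fuzzy positive implicative filter with thresholds $(\alpha,\beta]$ of $L$ if and only if for every $t$ with $\alpha<t\le\beta$ for which $U(F;t)=\{x\in L\mid F(x)\ge t\}$ is non-empty, $U(F;t)$ is a positive implicative filter of $L$.
   Context: A $BL$-algebra is an algebra $(L,\le,\wedge,\vee,\odot,\rightarrow,0,1)$ that is a bounded lattice (least element $0$, greatest element $1$) such that $(L,\odot,1)$ is a commutative monoid, $z\le x\rightarrow y$ iff $x\odot z\le y$, $x\wedge y=x\odot(x\rightarrow y)$, and $(x\rightarrow y)\vee(y\rightarrow x)=1$, for all $x,y,z\in L$. A filter of $L$ is a non-empty subset $A\subseteq L$ with $1\in A$ such that $x\in A$ and $x\rightarrow y\in A$ imply $y\in A$; it is positive implicative if $x\rightarrow(y\rightarrow z)\in A$ and $x\rightarrow y\in A$ imply $x\rightarrow z\in A$ for all $x,y,z$. A fuzzy set $F$ is a fuzzy positive implicative filter with thresholds $(\alpha,\beta]$ of $L$ if for all $x,y,z\in L$: $\max\{F(x\odot y),\alpha\}\ge\min\{F(x),F(y),\beta\}$; whenever $x\le y$, $\max\{F(y),\alpha\}\ge\min\{F(x),\beta\}$; and $\max\{F(x\rightarrow z),\alpha\}\ge\min\{F(x\rightarrow(y\rightarrow z)),F(x\rightarrow y),\beta\}$. *)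

theory Defs
  imports Complex_Main
begin

text \<open>
  The least element \<open>0\<close> of a BL-algebra is \<^const>\<open>bot\<close>, the monoid operation is \<open>*\<close>, and
  the monoid unit \<open>1\<close> is the greatest element \<^const>\<open>top\<close> by the axiom \<open>one_eq_top\<close>.
\<close>

class bl_algebra = bounded_lattice + comm_monoid_mult +
  fixes residuum :: "'a \<Rightarrow> 'a \<Rightarrow> 'a"  (infixr "\<leadsto>" 60)
  assumes one_eq_top: "1 = top"
    and residuation: "z \<le> x \<leadsto> y \<longleftrightarrow> x * z \<le> y"
    and divisibility: "inf x y = x * (x \<leadsto> y)"
    and prelinearity: "sup (x \<leadsto> y) (y \<leadsto> x) = 1"

definition bl_filter :: "'a::bl_algebra set \<Rightarrow> bool" where
  "bl_filter A \<longleftrightarrow>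
     A \<noteq> {} \<and> 1 \<in> A \<and> (\<forall>x y. x \<in> A \<and> (x \<leadsto> y) \<in> A \<longrightarrow> y \<in> A)"

definition positive_implicative_filter :: "'a::bl_algebra set \<Rightarrow> bool" where
  "positive_implicative_filter A \<longleftrightarrow>
     bl_filter A \<and>
     (\<forall>x y z. (x \<leadsto> (y \<leadsto> z)) \<in> A \<and> (x \<leadsto> y) \<in> A \<longrightarrow> (x \<leadsto> z) \<in> A)"

definition fuzzy_set :: "('a \<Rightarrow> real) \<Rightarrow> bool" where
  "fuzzy_set F \<longleftrightarrow> (\<forall>x. F x \<in> {0..1})"

definition level_set :: "('a \<Rightarrow> real) \<Rightarrow> real \<Rightarrow> 'a set" where
  "level_set F t = {x. F x \<ge> t}"

definition fuzzy_positive_implicative_filter ::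
    "real \<Rightarrow> real \<Rightarrow> ('a::bl_algebra \<Rightarrow> real) \<Rightarrow> bool" where
  "fuzzy_positive_implicative_filter \<alpha> \<beta> F \<longleftrightarrow>
     fuzzy_set F \<and>
     (\<forall>x y. max (F (x * y)) \<alpha> \<ge> min (F x) (min (F y) \<beta>)) \<and>
     (\<forall>x y. x \<le> y \<longrightarrow> max (F y) \<alpha> \<ge> min (F x) \<beta>) \<and>
     (\<forall>x y z. max (F (x \<leadsto> z)) \<alpha> \<ge>
        min (F (x \<leadsto> (y \<leadsto> z))) (min (F (x \<leadsto> y)) \<beta>))"

end

theory Submission
  imports Defs
begin

text \<open>Two equivalences combine. In a linear order, an inequality with a minimum capped by
  \<beta> on the left and a maximum with \<alpha> on the right says exactly that every threshold t
  in (\<alpha>, \<beta>] lying below the premises lies below the conclusion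
  (\<open>min_le_max_iff_thresholds\<close>). Hence each fuzzy condition on F amounts to a crisp
  closure condition on all level sets with such t. On the algebraic side, a non-empty set is closed
  under modus ponens and contains 1 iff it is an up-set closed under the product
  (\<open>bl_filter_mult\<close>, \<open>bl_filter_upward_closed\<close>,
  \<open>bl_filterI\<close>), by residuation. The implicative condition has the same shape on both
  sides.\<close>

lemma le_iff_residuum_eq_one: "x \<le> y \<longleftrightarrow> x \<leadsto> y = 1" for x y :: "'a::bl_algebra"
  by (metis mult_1_right one_eq_top residuation top_greatest top_unique)

lemma residuum_mult_le: "x * (x \<leadsto> y) \<le> y" for x y :: "'a::bl_algebra"
  by (simp only: order.refl flip: residuation)

lemma bl_filter_upward_closed:
  assumes "bl_filter A" "x \<in> A" "x \<le> y"
  shows "y \<in> A"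
proof -
  have "x \<leadsto> y = 1"
    using assms(3) by (simp only: le_iff_residuum_eq_one)
  moreover have "1 \<in> A" and "(x \<leadsto> y) \<in> A \<Longrightarrow> y \<in> A"
    using assms(1,2) unfolding bl_filter_def by blast+
  ultimately show ?thesis
    by (simp only:)
qed

text \<open>By residuation x lies below \<open>y \<leadsto> x * y\<close>, so that residuum is in
  the filter, and modus ponens with y yields the product.\<close>

lemma bl_filter_mult:
  assumes "bl_filter A" "x \<in> A" "y \<in> A"
  shows "x * y \<in> A"
proof -
  have "x \<le> y \<leadsto> x * y"
    by (simp add: residuation mult.commute)
  then have "(y \<leadsto> x * y) \<in> A"
    using bl_filter_upward_closed assms by blast
  then show ?thesis
    using assms unfolding bl_filter_def by blast
qed

text \<open>Modus ponens follows because the product of x and \<open>x \<leadsto> y\<close> is in A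
  and lies below y; 1 is in A because it is the top of a non-empty up-set.\<close>

lemma bl_filterI:
  assumes "A \<noteq> {}"
    and mult: "\<And>x y. x \<in> A \<Longrightarrow> y \<in> A \<Longrightarrow> x * y \<in> A"
    and up: "\<And>x y. x \<in> A \<Longrightarrow> x \<le> y \<Longrightarrow> y \<in> A"
  shows "bl_filter A"
  unfolding bl_filter_def
proof (intro conjI allI impI)
  show "1 \<in> A"
    using assms(1) up top_greatest unfolding one_eq_top by blast
  show "y \<in> A" if "x \<in> A \<and> (x \<leadsto> y) \<in> A" for x y
    using that mult up residuum_mult_le by blast
qed (fact assms(1))

text \<open>This is the bridge between fuzzy inequalities and level sets: \<open>t \<le> F x\<close>
  is membership of x in the level set at t.\<close>

lemma min_le_max_iff_thresholds:
  fixes a b c \<alpha> \<beta> :: "'a::linorder"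
  shows "min a (min b \<beta>) \<le> max c \<alpha> \<longleftrightarrow>
    (\<forall>t. \<alpha> < t \<and> t \<le> \<beta> \<longrightarrow> t \<le> a \<longrightarrow> t \<le> b \<longrightarrow> t \<le> c)"
proof
  assume *: "\<forall>t. \<alpha> < t \<and> t \<le> \<beta> \<longrightarrow> t \<le> a \<longrightarrow> t \<le> b \<longrightarrow> t \<le> c"
  show "min a (min b \<beta>) \<le> max c \<alpha>"
  proof (cases "\<alpha> < min a (min b \<beta>)")
    case True
    \<comment> \<open>Once it exceeds \<alpha>, the left-hand side is itself an admissible
      threshold, and the largest one below both a and b.\<close>
    then have "min a (min b \<beta>) \<le> c"
      using *[rule_format, of "min a (min b \<beta>)"] by (simp add: min.coboundedI2)
    then show ?thesis
      by (simp add: le_max_iff_disj)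
  next
    case False
    then show ?thesis
      by (intro max.coboundedI2 leI)
  qed
next
  assume *: "min a (min b \<beta>) \<le> max c \<alpha>"
  show "\<forall>t. \<alpha> < t \<and> t \<le> \<beta> \<longrightarrow> t \<le> a \<longrightarrow> t \<le> b \<longrightarrow> t \<le> c"
  proof (intro allI impI)
    fix t assume "\<alpha> < t \<and> t \<le> \<beta>" "t \<le> a" "t \<le> b"
    then have "t \<le> max c \<alpha>"
      using * by (meson min.boundedI order.trans)
    \<comment> \<open>Strictness of \<open>\<alpha> < t\<close> rules out the alternative
      \<open>t \<le> \<alpha>\<close>.\<close>
    then show "t \<le> c"
      using \<open>\<alpha> < t \<and> t \<le> \<beta>\<close> by (auto simp: le_max_iff_disj)
  qed
qed

text \<open>The three fuzzy conditions are translated separately; in each, the quantifier over t is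
  moved outside those over the elements.\<close>

lemma fuzzy_positive_implicative_filter_iff_level_sets:
  "fuzzy_positive_implicative_filter \<alpha> \<beta> F \<longleftrightarrow> fuzzy_set F \<and>
    (\<forall>t. \<alpha> < t \<and> t \<le> \<beta> \<longrightarrow>
      (\<forall>x y. x \<in> level_set F t \<longrightarrow> y \<in> level_set F t \<longrightarrow> x * y \<in> level_set F t) \<and>
      (\<forall>x y. x \<in> level_set F t \<longrightarrow> x \<le> y \<longrightarrow> y \<in> level_set F t) \<and>
      (\<forall>x y z. (x \<leadsto> (y \<leadsto> z)) \<in> level_set F t \<longrightarrow> (x \<leadsto> y) \<in> level_set F t \<longrightarrow>
         (x \<leadsto> z) \<in> level_set F t))"
proof -
  have "min (F x) \<beta> \<le> max (F y) \<alpha> \<longleftrightarrow> (\<forall>t. \<alpha> < t \<and> t \<le> \<beta> \<longrightarrow> t \<le> F x \<longrightarrow> t \<le> F y)"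
    for x y
    \<comment> \<open>The condition with a single premise is the case of two equal premises.\<close>
    unfolding min_le_max_iff_thresholds[of "F x" "F x" \<beta> "F y" \<alpha>, unfolded min.left_idem]
    by simp
  then have up: "(\<forall>x y. x \<le> y \<longrightarrow> max (F y) \<alpha> \<ge> min (F x) \<beta>) \<longleftrightarrow>
      (\<forall>t. \<alpha> < t \<and> t \<le> \<beta> \<longrightarrow>
        (\<forall>x y. x \<in> level_set F t \<longrightarrow> x \<le> y \<longrightarrow> y \<in> level_set F t))"
    unfolding level_set_def mem_Collect_eq by iprover
  have mult: "(\<forall>x y. max (F (x * y)) \<alpha> \<ge> min (F x) (min (F y) \<beta>)) \<longleftrightarrow>
      (\<forall>t. \<alpha> < t \<and> t \<le> \<beta> \<longrightarrow>
        (\<forall>x y. x \<in> level_set F t \<longrightarrow> y \<in> level_set F t \<longrightarrow> x * y \<in> level_set F t))"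
    unfolding level_set_def mem_Collect_eq min_le_max_iff_thresholds by iprover
  have impl: "(\<forall>x y z. max (F (x \<leadsto> z)) \<alpha> \<ge>
        min (F (x \<leadsto> (y \<leadsto> z))) (min (F (x \<leadsto> y)) \<beta>)) \<longleftrightarrow>
      (\<forall>t. \<alpha> < t \<and> t \<le> \<beta> \<longrightarrow>
        (\<forall>x y z. (x \<leadsto> (y \<leadsto> z)) \<in> level_set F t \<longrightarrow> (x \<leadsto> y) \<in> level_set F t \<longrightarrow>
           (x \<leadsto> z) \<in> level_set F t))"
    unfolding level_set_def mem_Collect_eq min_le_max_iff_thresholds by iprover
  show ?thesis
    unfolding fuzzy_positive_implicative_filter_def up mult impl
    by (simp only: imp_conjR all_conj_distrib)
qed

theorem theorem3p2p7:
  fixes F :: "'a::bl_algebra \<Rightarrow> real" and \<alpha> \<beta> :: real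
  assumes "\<alpha> \<in> {0<..1}" and "\<beta> \<in> {0<..1}" and "\<alpha> < \<beta>"
    and "fuzzy_set F"
  shows "fuzzy_positive_implicative_filter \<alpha> \<beta> F \<longleftrightarrow>
    (\<forall>t. \<alpha> < t \<and> t \<le> \<beta> \<and> level_set F t \<noteq> {} \<longrightarrow>
       positive_implicative_filter (level_set F t))"
proof -
  \<comment> \<open>For empty A both sides hold vacuously, which is why the closure conditions need
    no guard for non-emptiness.\<close>
  have "(A \<noteq> {} \<longrightarrow> positive_implicative_filter A) \<longleftrightarrow>
      (\<forall>x y. x \<in> A \<longrightarrow> y \<in> A \<longrightarrow> x * y \<in> A) \<and>
      (\<forall>x y. x \<in> A \<longrightarrow> x \<le> y \<longrightarrow> y \<in> A) \<and>
      (\<forall>x y z. (x \<leadsto> (y \<leadsto> z)) \<in> A \<longrightarrow> (x \<leadsto> y) \<in> A \<longrightarrow> (x \<leadsto> z) \<in> A)" (is "?L \<longleftrightarrow> ?R")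
    for A :: "'a set"
  proof
    assume ?L
    then show ?R
      unfolding positive_implicative_filter_def
      using bl_filter_mult[of A] bl_filter_upward_closed[of A] by blast
  next
    assume ?R
    then show ?L
      unfolding positive_implicative_filter_def using bl_filterI[of A] by blast
  qed
  from this[symmetric] show ?thesis
    using assms(4) by (simp only: fuzzy_positive_implicative_filter_iff_level_sets) blast
qed

end
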